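(* (a) Let $n\ge 2$ and let $r=(r_1,\ldots,r_{2n})$ with $r_i>0$ for all $i$. Then the (normalized) symplectic volume of the moduli space of Euclidean $2n$-gons with side-lengths $r$ is $$V^{\mathbb{E}^3}(r)=-\frac{1}{4\,(2n-3)!}\sum_{I\subset\{1,\ldots,2n\}}(-1)^{|I|}\left|\sum_{i\in I}r_i-\sum_{i\in\bar I}r_i\right|^{2n-3}.$$ (b) Let $n\ge 1$ and let $r=(r_1,\ldots,r_{2n+1})$ with $r_i>0$ for all $i$. Then the (normalized) symplectic volume of the moduli space of Euclidean $(2n+1)$-gons with side-lengths $r$ is $$V^{\mathbb{E}^3}(r)=-\frac{1}{2\,(2n-2)!}\sum_{\substack{I\subset\{1,\ldots,2n+1\}\\ |I|\text{ odd}}}\mathrm{sign}\left(\sum_{i\in I}r_i-\sum_{i\in\bar I}r_i\right)\left(\sum_{i\in I}r_i-\sum_{i\in\bar I}r_i\right)^{2n-2}.$$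
   Context: Notation: $\bar I$ is the complement of $I$ in the index set, $|I|$ is the cardinality of $I$, $\mathrm{sign}(x)\in\{-1,0,1\}$ is the sign of $x$ with $\mathrm{sign}(0)=0$, and $0^0=1$. An $N$-gon in $\mathbb{E}^3$ (Euclidean 3-space) is given by vertices $(v_1,\ldots,v_N)$ joined in cyclic order by segments $e_i$ from $v_i$ to $v_{i+1}$ (indices mod $N$), with side-lengths $r_i=\mathrm{length}(e_i)>0$. The moduli space of polygons with side-lengths $r=(r_1,\ldots,r_N)$ is the space of all such polygons modulo the group $\mathbb{E}^+(3)$ of orientation-preserving isometries. It is identified with $\mu_r^{-1}(0)/SO(3)$, where $\mu_r:(S^2)^N\to\mathbb{R}^3$, $\mu_r(u_1,\ldots,u_N)=\sum_i r_iu_i$. This is the symplectic quotient of $(S^2)^N$ with symplectic form $\sum_i r_i\omega_i$ ($\omega_i$ the area form of the $i$-th unit sphere) by the diagonal $SO(3)$ action. $V^{\mathbb{E}^3}(r)$ denotes the symplectic volume of this space, normalized (Liouville volume divided by $(2\pi)^{N-3}$) to agree with the volume of the moduli space of polygons in $\mathbb{S}^3$ for small side-lengths. Precisely, $V^{\mathbb{E}^3}(\lambda r)=\lambda^{N-3}V^{\mathbb{E}^3}(r)$ for all $\lambda>0$, and $V^{\mathbb{E}^3}(r)=V^{\mathbb{S}^3}(r)$ whenever all $r_i$ are sufficiently small. Here $V^{\mathbb{S}^3}(r)$ is the symplectic volume of the moduli space of polygons in the unit sphere $\mathbb{S}^3$ with side-lengths $r$ ($0<r_i<\pi$), given by Witten's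 formula $$V^{\mathbb{S}^3}(r)=\frac{2^{N-1}}{\pi}\sum_{k=1}^\infty\frac{\sin kr_1\cdots\sin kr_N}{k^{N-2}}.$$ These two properties may be taken as determining $V^{\mathbb{E}^3}$. *)

theory Defs imports Complex_Main begin

text \<open>
  The side-lengths of an \<open>N\<close>-gon are the values \<open>r 1, \<dots>, r N\<close> of a function on the naturals;
  values outside \<open>{1..N}\<close> are irrelevant.
\<close>

definition side_lengths :: "nat \<Rightarrow> (nat \<Rightarrow> real) \<Rightarrow> bool" where
  "side_lengths N r \<longleftrightarrow> (\<forall>i\<in>{1..N}. 0 < r i)"

text \<open>
  Witten's formula for the symplectic volume of the moduli space of \<open>N\<close>-gons in the unit 3-sphere,
  for \<open>N \<ge> 3\<close> and side-lengths in \<open>(0, \<pi>)\<close>. The summation index is shifted by one, so that the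
  term for \<open>k\<close> belongs to frequency \<open>Suc k\<close>. For \<open>N = 3\<close> the series converges only
  conditionally, in the order in which it is written.
\<close>

definition volume_S3 :: "nat \<Rightarrow> (nat \<Rightarrow> real) \<Rightarrow> real" where
  "volume_S3 N r = 2 ^ (N - 1) / pi *
     (\<Sum>k. (\<Prod>i\<in>{1..N}. sin (real (Suc k) * r i)) / real (Suc k) ^ (N - 2))"

text \<open>
  The normalized symplectic volume of the moduli space of Euclidean \<open>N\<close>-gons is determined, as a
  function of the side-lengths, by being homogeneous of degree \<open>N - 3\<close> and by agreeing with the
  spherical volume when all side-lengths are small.
\<close>

definition is_volume_E3 :: "nat \<Rightarrow> ((nat \<Rightarrow> real) \<Rightarrow> real) \<Rightarrow> bool" where
  "is_volume_E3 N V \<longleftrightarrow>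
     (\<forall>r c. side_lengths N r \<longrightarrow> 0 < c \<longrightarrow> V (\<lambda>i. c * r i) = c ^ (N - 3) * V r) \<and>
     (\<exists>\<epsilon>>0. \<forall>r. side_lengths N r \<longrightarrow> (\<forall>i\<in>{1..N}. r i < \<epsilon>) \<longrightarrow> V r = volume_S3 N r)"

text \<open>
  The two properties leave \<open>V\<close> unspecified on functions that are not positive on \<open>{1..N}\<close>, so
  the description is of the value at \<open>r\<close> rather than of the function \<open>V\<close>. To evaluate it one has
  to show that a function with the two properties exists.
\<close>

definition volume_E3 :: "nat \<Rightarrow> (nat \<Rightarrow> real) \<Rightarrow> real" where
  "volume_E3 N r = (THE v. \<exists>V. is_volume_E3 N V \<and> V r = v)"

end

theory Submission
  imports Defs "HOL-Analysis.Analysis" "HOL-Computational_Algebra.Polynomial" "HOL-Real_Asymp.Real_Asymp"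
begin

text \<open>
  Expanding the product of sines turns Witten's series into an alternating sum, over the subsets
  \<open>I\<close>, of the series \<open>\<Sum>k. cos (k s - (N - 2) \<pi> / 2) / k^(N - 2)\<close> at the signed sums
  \<open>s = s\<^sub>I\<close> of the side-lengths. For \<open>\<bar>s\<bar> < 2 \<pi>\<close> this series is a polynomial of degree at most
  \<open>N - 2\<close> plus a multiple of \<open>sgn s * s^(N - 3)\<close>: for \<open>N = 3\<close> it is the sawtooth series, which
  converges locally uniformly away from the jump at \<open>0\<close>, and the general case follows by
  integrating term by term. The alternating sum is an \<open>N\<close>-fold difference, so it annihilates the
  polynomial, and only the homogeneous part of degree \<open>N - 3\<close> remains.
\<close>

subsection \<open>Fourier series of the periodic Bernoulli functions\<close>

text \<open>
  The phase makes \<open>fourier_term p k\<close> the derivative of \<open>fourier_term (Suc p) k\<close>, so that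
  sine and cosine series are handled by one induction. Up to the factor \<open>- (2 \<pi>)^p / (2 p!)\<close>, the
  sum over \<open>k\<close> is the \<open>p\<close>-th Bernoulli polynomial at \<open>x / (2 \<pi>)\<close>, continued periodically.
\<close>

definition fourier_term :: "nat \<Rightarrow> nat \<Rightarrow> real \<Rightarrow> real" where
  "fourier_term p k x = cos (real (Suc k) * x - real p * pi / 2) / real (Suc k) ^ p"

definition fourier_sum :: "nat \<Rightarrow> real \<Rightarrow> real" where
  "fourier_sum p x = (\<Sum>k. fourier_term p k x)"

lemma fourier_term_1: "fourier_term 1 k x = sin (real (Suc k) * x) / real (Suc k)"
  by (simp add: fourier_term_def cos_diff)

lemma has_field_derivative_fourier_term:
  "(fourier_term (Suc p) k has_field_derivative fourier_term p k x) (at x within S)"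
proof -
  have "cos (real (Suc k) * x - real p * pi / 2) = - sin (real (Suc k) * x - real (Suc p) * pi / 2)"
    using sin_diff [of "real (Suc k) * x - real p * pi / 2" "pi / 2"]
    by (simp add: algebra_simps add_divide_distrib)
  then show ?thesis
    unfolding fourier_term_def
    by (auto intro!: derivative_eq_intros simp del: of_nat_Suc)
qed

section \<open>Uniform convergence of the sawtooth series\<close>

text \<open>Each new cosine, multiplied by \<open>2 * sin (x / 2)\<close>, is a difference of two
  sines, so the sum telescopes. The product form avoids division where \<open>sin (x / 2)\<close>
  vanishes.\<close>

lemma dirichlet_kernel:
  fixes x :: real
  shows "2 * sin (x / 2) * (1 / 2 + (\<Sum>k<n. cos (real (Suc k) * x))) = sin ((real n + 1 / 2) * x)"
proof (induction n)
  case (Suc n)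
  have "(real (Suc n) + 1 / 2) * x = real (Suc n) * x + x / 2"
    "(real n + 1 / 2) * x = real (Suc n) * x - x / 2"
    by (simp_all add: algebra_simps)
  then have "2 * sin (x / 2) * cos (real (Suc n) * x) =
      sin ((real (Suc n) + 1 / 2) * x) - sin ((real n + 1 / 2) * x)"
    by (simp add: sin_add sin_diff)
  then show ?case
    using Suc by (simp add: algebra_simps)
qed (simp add: field_simps)

text \<open>The error plus an explicit correction vanishes at \<open>pi\<close> and has derivative
  of order 1/n, so the mean value inequality bounds it; the correction is itself of order 1/n. The
  constant depends on \<open>d\<close> only, which makes the convergence uniform.\<close>

lemma sawtooth_bound_pos:
  fixes x d :: real
  assumes d: "0 < d" "d \<le> x" "x \<le> 2 * pi - d"
  shows "\<bar>(\<Sum>k<n. fourier_term 1 k x) - (pi / 2 - x / 2)\<bar>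
     \<le> (pi / (sin (d / 2))\<^sup>2 + 1 / sin (d / 2)) / real (2 * n + 1)"
proof -
  \<comment> \<open>The added term cancels the Dirichlet kernel up to order \<open>1/n\<close> in the derivative, as integrating
    the kernel by parts would. Moreover \<open>h\<close> vanishes at \<open>\<pi>\<close>.\<close>
  define h where "h = (\<lambda>x::real. (\<Sum>k<n. fourier_term 1 k x) - (pi / 2 - x / 2)
      + cos ((real n + 1 / 2) * x) / (real (2 * n + 1) * sin (x / 2)))"
  define h' where "h' = (\<lambda>x::real. - cos ((real n + 1 / 2) * x) * cos (x / 2)
      / (2 * real (2 * n + 1) * (sin (x / 2))\<^sup>2))"
  let ?S = "{d..2 * pi - d}"
  have dpi: "d \<le> pi" using d by linarith
  have sd: "0 < sin (d / 2)" using d dpi by (intro sin_gt_zero) auto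
  \<comment> \<open>The half angle \<open>z / 2\<close> lies between \<open>d / 2\<close> and
    \<open>pi - d / 2\<close>. To the right of \<open>pi / 2\<close> it is reflected, so that
    monotonicity of sine applies on both halves.\<close>
  have sin_ge: "sin (d / 2) \<le> sin (z / 2)" if "z \<in> ?S" for z
  proof (cases "z \<le> pi")
    case True
    then show ?thesis using that d by (intro sin_monotone_2pi_le) auto
  next
    case False
    have "sin (d / 2) \<le> sin (pi - z / 2)"
      using that d False by (intro sin_monotone_2pi_le) auto
    then show ?thesis by simp
  qed
  have deriv: "(h has_field_derivative h' z) (at z within ?S)" if z: "z \<in> ?S" for z
  proof -
    have s: "sin (z / 2) > 0" using sin_ge [OF z] sd by linarith
    have ft: "(fourier_term 1 k has_field_derivative cos (real (Suc k) * z)) (at z within ?S)" for k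
      using has_field_derivative_fourier_term [of 0 k z] by (simp add: fourier_term_def)
    \<comment> \<open>Differentiating the cosine produces the factor \<open>n + 1 / 2\<close>, which
      is half of \<open>2 * n + 1\<close>. The quotient therefore yields exactly minus the Dirichlet
      kernel, and only \<open>h' z\<close> survives in the derivative of \<open>h\<close>.\<close>
    have "((\<lambda>x. cos ((real n + 1 / 2) * x) / (real (2 * n + 1) * sin (x / 2))) has_field_derivative
        h' z - sin ((real n + 1 / 2) * z) / (2 * sin (z / 2))) (at z within ?S)"
      unfolding h'_def using s
      by (auto intro!: derivative_eq_intros simp: divide_simps power2_eq_square)
         (simp add: algebra_simps)
    moreover have "sin ((real n + 1 / 2) * z) / (2 * sin (z / 2)) =
        1 / 2 + (\<Sum>k<n. cos (real (Suc k) * z))"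
      using dirichlet_kernel [of z n] s by (simp add: field_simps)
    moreover have "((\<lambda>x. \<Sum>k<n. fourier_term 1 k x) has_field_derivative
        (\<Sum>k<n. cos (real (Suc k) * z))) (at z within ?S)"
      by (intro DERIV_sum ft)
    moreover have "((\<lambda>x. pi / 2 - x / 2) has_field_derivative - (1 / 2)) (at z within ?S)"
      by (auto intro!: derivative_eq_intros)
    ultimately have "(h has_field_derivative (\<Sum>k<n. cos (real (Suc k) * z)) - - (1 / 2)
        + (h' z - (1 / 2 + (\<Sum>k<n. cos (real (Suc k) * z))))) (at z within ?S)"
      unfolding h_def by (intro DERIV_add DERIV_diff) simp_all
    then show ?thesis by simp
  qed
  have bound: "norm (h' z) \<le> 1 / (real (2 * n + 1) * (sin (d / 2))\<^sup>2)" if z: "z \<in> ?S" for z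
  proof -
    have "\<bar>cos ((real n + 1 / 2) * z) * cos (z / 2)\<bar> \<le> 1 * 1"
      unfolding abs_mult by (intro mult_mono) auto
    moreover have "(sin (d / 2))\<^sup>2 \<le> (sin (z / 2))\<^sup>2"
      using sin_ge [OF z] sd by (intro power_mono) auto
    ultimately have "norm (h' z) \<le> 1 / (2 * real (2 * n + 1) * (sin (d / 2))\<^sup>2)"
      unfolding h'_def real_norm_def abs_divide using sd
      by (intro frac_le) (auto simp: abs_mult)
    also have "\<dots> \<le> 1 / (real (2 * n + 1) * (sin (d / 2))\<^sup>2)"
      using sd by (intro divide_left_mono mult_right_mono mult_pos_pos) auto
    finally show ?thesis .
  qed
  have "h pi = 0"
  proof -
    have "cos ((real n + 1 / 2) * pi) = 0"
      by (simp add: distrib_right cos_add)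
    moreover have "fourier_term 1 k pi = 0" for k
      unfolding fourier_term_1 by (simp del: of_nat_Suc)
    ultimately show ?thesis by (simp add: h_def)
  qed
  have "norm (h x - h pi) \<le> 1 / (real (2 * n + 1) * (sin (d / 2))\<^sup>2) * norm (x - pi)"
    by (rule field_differentiable_bound [OF _ deriv bound]) (use d dpi in auto)
  also have "\<dots> \<le> 1 / (real (2 * n + 1) * (sin (d / 2))\<^sup>2) * pi"
    using d by (intro mult_left_mono) (auto simp: abs_le_iff)
  finally have hx: "\<bar>h x\<bar> \<le> pi / (sin (d / 2))\<^sup>2 / real (2 * n + 1)"
    using \<open>h pi = 0\<close> by (simp add: field_simps)
  have "\<bar>cos ((real n + 1 / 2) * x) / (real (2 * n + 1) * sin (x / 2))\<bar>
      \<le> 1 / (real (2 * n + 1) * sin (d / 2))"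
    unfolding abs_divide using sd sin_ge [of x] d
    by (intro frac_le) (auto simp: abs_mult)
  then have "\<bar>cos ((real n + 1 / 2) * x) / (real (2 * n + 1) * sin (x / 2))\<bar>
      \<le> 1 / sin (d / 2) / real (2 * n + 1)"
    by (simp add: mult.commute)
  with hx show ?thesis
    unfolding add_divide_distrib h_def by linarith
qed

text \<open>Negative \<open>x\<close> reduces to positive \<open>x\<close>, since both the partial
  sums and the limit are odd.\<close>

lemma sawtooth_bound:
  fixes x d :: real
  assumes "0 < d" "d \<le> \<bar>x\<bar>" "\<bar>x\<bar> \<le> 2 * pi - d"
  shows "\<bar>(\<Sum>k<n. fourier_term 1 k x) - (sgn x * pi / 2 - x / 2)\<bar>
     \<le> (pi / (sin (d / 2))\<^sup>2 + 1 / sin (d / 2)) / real (2 * n + 1)"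
proof (cases "x > 0")
  case True
  then show ?thesis using sawtooth_bound_pos [of d x n] assms by simp
next
  case False
  have "(\<Sum>k<n. fourier_term 1 k (- x)) = - (\<Sum>k<n. fourier_term 1 k x)"
    unfolding fourier_term_1 by (simp add: sum_negf)
  moreover have "x < 0" using False assms by auto
  ultimately show ?thesis
    using sawtooth_bound_pos [of d "- x" n] assms by (simp add: abs_le_iff)
qed

lemma uniform_limit_sawtooth:
  assumes d: "0 < d" "d < 2 * pi"
  shows "uniform_limit {x. d \<le> \<bar>x\<bar> \<and> \<bar>x\<bar> \<le> 2 * pi - d} (\<lambda>n x. \<Sum>k<n. fourier_term 1 k x)
    (\<lambda>x. sgn x * pi / 2 - x / 2) sequentially"
proof (rule uniform_limitI)
  fix e :: real assume "e > 0"
  define K where "K = pi / (sin (d / 2))\<^sup>2 + 1 / sin (d / 2)"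
  have "(\<lambda>n. K / real (2 * n + 1)) \<longlonglongrightarrow> 0"
    by real_asymp
  then have "\<forall>\<^sub>F n in sequentially. K / real (2 * n + 1) < e"
    using \<open>e > 0\<close> by (rule order_tendstoD)
  then show "\<forall>\<^sub>F n in sequentially. \<forall>x\<in>{x. d \<le> \<bar>x\<bar> \<and> \<bar>x\<bar> \<le> 2 * pi - d}.
      dist (\<Sum>k<n. fourier_term 1 k x) (sgn x * pi / 2 - x / 2) < e"
  proof eventually_elim
    case (elim n)
    then show ?case
      using sawtooth_bound [of d _ n] d unfolding K_def dist_real_def by fastforce
  qed
qed

text \<open>At the jump \<open>x = 0\<close> every term vanishes, in agreement with
  \<open>sgn 0 = 0\<close>. Any other \<open>x\<close> lies in a region of uniform convergence, with
  \<open>d\<close> the distance from \<open>\<bar>x\<bar>\<close> to the nearer of 0 and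
  \<open>2 * pi\<close>.\<close>

lemma fourier_sums_1:
  assumes "\<bar>x\<bar> < 2 * pi"
  shows "(\<lambda>k. fourier_term 1 k x) sums (sgn x * pi / 2 - x / 2)"
proof (cases "x = 0")
  case True
  then show ?thesis unfolding fourier_term_1 by simp
next
  case False
  define d where "d = min \<bar>x\<bar> (2 * pi - \<bar>x\<bar>)"
  have "0 < d" "d < 2 * pi" "d \<le> \<bar>x\<bar>" "\<bar>x\<bar> \<le> 2 * pi - d"
    using False assms by (auto simp: d_def min_def)
  then show ?thesis
    unfolding sums_def using tendsto_uniform_limitI [OF uniform_limit_sawtooth] by simp
qed

section \<open>Higher orders by term-by-term differentiation\<close>

lemma uniform_limit_fourier_sum:
  assumes "p \<ge> 2"
  shows "uniform_limit UNIV (\<lambda>n x. \<Sum>k<n. fourier_term p k x) (fourier_sum p) sequentially"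
proof -
  have "summable (\<lambda>k. inverse (real (Suc k) ^ p))"
    using inverse_power_summable [OF assms, where ?'a = real]
    by (subst summable_Suc_iff [where f = "\<lambda>k. inverse (real k ^ p)"])
  moreover have "norm (fourier_term p k x) \<le> inverse (real (Suc k) ^ p)" for k x
    by (simp add: fourier_term_def abs_mult divide_simps del: of_nat_Suc)
  ultimately show ?thesis
    unfolding fourier_sum_def [abs_def] by (intro Weierstrass_m_test)
qed

lemma summable_fourier_term:
  assumes "p \<ge> 1" "\<bar>x\<bar> < 2 * pi"
  shows "summable (\<lambda>k. fourier_term p k x)"
proof (cases "p = 1")
  case True
  then show ?thesis using fourier_sums_1 [OF assms(2)] by (simp add: sums_iff)
next
  case False
  then have "p \<ge> 2" using assms by simp
  from tendsto_uniform_limitI [OF uniform_limit_fourier_sum [OF this]]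
  show ?thesis by (auto simp: summable_def sums_def)
qed

lemma fourier_sum_1:
  assumes "\<bar>x\<bar> < 2 * pi"
  shows "fourier_sum 1 x = sgn x * pi / 2 - x / 2"
  unfolding fourier_sum_def using fourier_sums_1 [OF assms] by (rule sums_unique [symmetric])

lemma continuous_on_fourier_sum:
  assumes "p \<ge> 2"
  shows "continuous_on S (fourier_sum p)"
proof -
  have "continuous_on UNIV (fourier_sum p)"
    by (rule uniform_limit_theorem [OF _ uniform_limit_fourier_sum [OF assms]])
       (auto simp: fourier_term_def intro!: always_eventually continuous_intros)
  then show ?thesis by (rule continuous_on_subset) simp
qed

text \<open>Term-by-term differentiation needs the differentiated series to converge uniformly near
  \<open>x\<close>. For \<open>p = 1\<close> this is the sawtooth estimate away from the jumps, for
  larger \<open>p\<close> the M-test.\<close>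

lemma has_field_derivative_fourier_sum:
  assumes p: "p \<ge> 1" and x: "\<bar>x\<bar> < 2 * pi" "x \<noteq> 0"
  shows "(fourier_sum (Suc p) has_field_derivative fourier_sum p x) (at x)"
proof -
  \<comment> \<open>Half the distance from \<open>\<bar>x\<bar>\<close> to the nearer of 0 and
    \<open>2 * pi\<close>, so that every point of the ball still keeps distance \<open>e\<close>
    from the jumps.\<close>
  define e where "e = min \<bar>x\<bar> (2 * pi - \<bar>x\<bar>) / 2"
  have e: "0 < e" "e < 2 * pi" and "2 * e \<le> \<bar>x\<bar>" "2 * e \<le> 2 * pi - \<bar>x\<bar>"
    using x by (auto simp: e_def min_def)
  then have sub: "ball x e \<subseteq> {y. e \<le> \<bar>y\<bar> \<and> \<bar>y\<bar> \<le> 2 * pi - e}"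
    by (auto simp: dist_real_def)
  have lim: "uniform_limit (ball x e) (\<lambda>n x. \<Sum>k<n. fourier_term p k x) (fourier_sum p) sequentially"
  proof (cases "p = 1")
    case True
    have "uniform_limit (ball x e) (\<lambda>n x. \<Sum>k<n. fourier_term 1 k x)
        (\<lambda>x. sgn x * pi / 2 - x / 2) sequentially"
      using uniform_limit_on_subset [OF uniform_limit_sawtooth [OF e] sub] .
    moreover have "fourier_sum 1 y = sgn y * pi / 2 - y / 2" if "y \<in> ball x e" for y
      using that sub e by (intro fourier_sum_1) auto
    ultimately show ?thesis
      unfolding True by (subst uniform_limit_cong') auto
  next
    case False
    then have "p \<ge> 2" using p by simp
    then show ?thesis
      by (intro uniform_limit_on_subset [OF uniform_limit_fourier_sum]) auto
  qed
  have "\<exists>g. \<forall>y\<in>ball x e. (\<lambda>k. fourier_term (Suc p) k y) sums g y \<and>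
      (g has_field_derivative fourier_sum p y) (at y within ball x e)"
    by (rule has_field_derivative_series [OF _ has_field_derivative_fourier_term lim, of x])
       (use x p e summable_fourier_term in auto)
  then obtain g where g: "\<And>y. y \<in> ball x e \<Longrightarrow> (\<lambda>k. fourier_term (Suc p) k y) sums g y"
      "(g has_field_derivative fourier_sum p x) (at x within ball x e)"
    using e by (meson centre_in_ball)
  have "(g has_field_derivative fourier_sum p x) (at x)"
    using g(2) e by (simp add: at_within_open [of x "ball x e"])
  then show ?thesis
    by (rule has_field_derivative_transform_within_open [of _ _ _ "ball x e"])
       (use e g(1) in \<open>auto simp: fourier_sum_def sums_iff\<close>)
qed

lemma poly_antiderivative:
  fixes p :: "'a :: field_char_0 poly"
  obtains q where "pderiv q = p" "degree q \<le> Suc (degree p)"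
proof
  let ?q = "\<Sum>i\<le>degree p. monom (coeff p i / of_nat (Suc i)) (Suc i)"
  show "pderiv ?q = p"
    by (rule poly_eqI) (simp add: coeff_pderiv coeff_sum coeff_eq_0 del: of_nat_Suc)
  show "degree ?q \<le> Suc (degree p)"
    by (intro degree_sum_le) (auto intro!: order_trans [OF degree_monom_le])
qed

lemma has_field_derivative_sgn_power:
  fixes x :: real
  assumes "x \<noteq> 0"
  shows "((\<lambda>x. sgn x * x ^ Suc p / fact (Suc p)) has_field_derivative sgn x * x ^ p / fact p) (at x)"
proof -
  \<comment> \<open>The sign is frozen at \<open>x\<close> here; near a nonzero \<open>x\<close> it
    is constant anyway.\<close>
  have "((\<lambda>y. sgn x * y ^ Suc p / fact (Suc p)) has_field_derivative sgn x * x ^ p / fact p) (at x)"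
    by (auto intro!: derivative_eq_intros simp: divide_simps simp del: power_Suc)
  moreover have "\<forall>\<^sub>F y in nhds x. sgn x * y ^ Suc p / fact (Suc p) = sgn y * y ^ Suc p / fact (Suc p)"
  proof -
    have "\<forall>\<^sub>F y in nhds x. y \<in> (if x > 0 then {0<..} else {..<0})"
      using assms by (intro eventually_nhds_in_open) auto
    then show ?thesis
      by eventually_elim (use assms in \<open>auto split: if_splits\<close>)
  qed
  ultimately show ?thesis
    by (subst DERIV_cong_ev [OF refl _ refl, symmetric])
qed

text \<open>One factor of the power absorbs the sign into an absolute value; the exponent has to be
  positive, as \<open>sgn\<close> itself jumps at 0.\<close>

lemma continuous_on_sgn_power: "continuous_on S (\<lambda>x::real. sgn x * x ^ Suc p)"
proof -
  have "(\<lambda>x::real. sgn x * x ^ Suc p) = (\<lambda>x. \<bar>x\<bar> * x ^ p)"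
    by (auto simp: abs_sgn fun_eq_iff)
  then show ?thesis by (simp only:) (intro continuous_intros)
qed

text \<open>Integrate once per induction step, starting from the sawtooth. The antiderivative of the
  right-hand side is determined up to a constant, which goes into the polynomial.\<close>

lemma fourier_sum_eq_poly:
  "\<exists>P. degree P \<le> Suc p \<and>
     (\<forall>x. \<bar>x\<bar> < 2 * pi \<longrightarrow> fourier_sum (Suc p) x = poly P x + pi / 2 * (sgn x * x ^ p / fact p))"
proof (induction p)
  case 0
  show ?case
    by (rule exI [of _ "[:0, - 1 / 2:]"]) (use fourier_sum_1 in auto)
next
  case (Suc p)
  then obtain P where P: "degree P \<le> Suc p"
    "\<And>x. \<bar>x\<bar> < 2 * pi \<Longrightarrow> fourier_sum (Suc p) x = poly P x + pi / 2 * (sgn x * x ^ p / fact p)"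
    by blast
  obtain Q where Q: "pderiv Q = P" "degree Q \<le> Suc (degree P)"
    by (rule poly_antiderivative)
  define g where "g = (\<lambda>x. fourier_sum (Suc (Suc p)) x
    - (poly Q x + pi / 2 * (sgn x * x ^ Suc p / fact (Suc p))))"
  let ?S = "{- 2 * pi <..< 2 * pi}"
  have "g constant_on ?S"
  \<comment> \<open>The derivative of \<open>g\<close> vanishes off 0 only; continuity of
    \<open>g\<close> at 0 forces the constants on the two sides to agree.\<close>
  proof (rule DERIV_zero_connected_constant_on [where K = "{0}"])
    show "continuous_on ?S g"
      unfolding g_def
      by (intro continuous_intros continuous_on_fourier_sum continuous_on_sgn_power) auto
    show "\<forall>x\<in>?S - {0}. (g has_field_derivative 0) (at x)"
    proof
      fix x assume "x \<in> ?S - {0}"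
      then have x: "\<bar>x\<bar> < 2 * pi" "x \<noteq> 0" by auto
      have "(g has_field_derivative fourier_sum (Suc p) x
          - (poly P x + pi / 2 * (sgn x * x ^ p / fact p))) (at x)"
        unfolding g_def Q(1) [symmetric]
        by (intro DERIV_diff DERIV_add DERIV_cmult has_field_derivative_sgn_power poly_DERIV
            has_field_derivative_fourier_sum x) auto
      then show "(g has_field_derivative 0) (at x)"
        by (simp only: P(2) [OF x(1)] diff_self)
    qed
  qed auto
  then obtain c where c: "\<And>x. x \<in> ?S \<Longrightarrow> g x = c"
    unfolding constant_on_def by blast
  show ?case
  proof (intro exI [of _ "Q + [:c:]"] conjI allI impI)
    show "degree (Q + [:c:]) \<le> Suc (Suc p)"
      using P(1) Q(2) by (intro degree_add_le) auto
    fix x :: real assume "\<bar>x\<bar> < 2 * pi"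
    then have "g x = c" by (intro c) auto
    then show "fourier_sum (Suc (Suc p)) x
        = poly (Q + [:c:]) x + pi / 2 * (sgn x * x ^ Suc p / fact (Suc p))"
      unfolding g_def by simp
  qed
qed

subsection \<open>Alternating sums over sign choices\<close>

text \<open>The index set \<open>A\<close> is a parameter so that inductions can add one index at a
  time.\<close>

definition signed_sum :: "('a \<Rightarrow> real) \<Rightarrow> 'a set \<Rightarrow> 'a set \<Rightarrow> real" where
  "signed_sum r A I = (\<Sum>i\<in>I. r i) - (\<Sum>i\<in>A - I. r i)"

lemma sum_Pow_insert:
  assumes "finite A" "a \<notin> A"
  shows "(\<Sum>I\<in>Pow (insert a A). f I) = (\<Sum>I\<in>Pow A. f I + f (insert a I))"
proof -
  have "inj_on (insert a) (Pow A)" using assms(2) by (auto simp: inj_on_def)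
  moreover have "Pow A \<inter> insert a ` Pow A = {}" using assms(2) by auto
  ultimately show ?thesis
    using assms by (simp add: Pow_insert sum.union_disjoint sum.reindex sum.distrib)
qed

lemma signed_sum_insert:
  assumes "finite A" "a \<notin> A" "I \<subseteq> A"
  shows "signed_sum r (insert a A) I = signed_sum r A I - r a"
    and "signed_sum r (insert a A) (insert a I) = signed_sum r A I + r a"
proof -
  have "finite I" "a \<notin> I" using assms finite_subset by auto
  moreover have "insert a A - I = insert a (A - I)" "insert a A - insert a I = A - I"
    using assms by auto
  ultimately show "signed_sum r (insert a A) I = signed_sum r A I - r a"
    "signed_sum r (insert a A) (insert a I) = signed_sum r A I + r a"
    using assms by (auto simp: signed_sum_def)
qed

lemma card_insert_Diff:
  assumes "finite A" "a \<notin> A" "I \<subseteq> A"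
  shows "card (insert a A - I) = Suc (card (A - I))"
    and "card (insert a A - insert a I) = card (A - I)"
proof -
  have "insert a A - I = insert a (A - I)" "insert a A - insert a I = A - I"
    using assms by auto
  then show "card (insert a A - I) = Suc (card (A - I))"
    "card (insert a A - insert a I) = card (A - I)"
    using assms by auto
qed

text \<open>Multiplying a cosine by \<open>2 * sin b\<close> gives the difference of its shifts by
  \<open>b\<close> and \<open>- b\<close>, each delayed by the phase \<open>pi / 2\<close>. The sign
  records how many indices took the negative shift.\<close>

lemma prod_sin_eq_sum_cos:
  assumes "finite A"
  shows "2 ^ card A * (\<Prod>i\<in>A. sin (r i)) =
    (\<Sum>I\<in>Pow A. (- 1) ^ card (A - I) * cos (signed_sum r A I - real (card A) * pi / 2))"
  using assms
proof (induction A rule: finite_induct)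
  case (insert a A)
  have step: "2 * sin b * cos (u - real n * pi / 2) =
      cos (u + b - real (Suc n) * pi / 2) - cos (u - b - real (Suc n) * pi / 2)" for b u n
  proof -
    have "2 * sin b * cos v = cos (v + b - pi / 2) - cos (v - b - pi / 2)" for v
      by (simp add: cos_diff sin_add sin_diff)
    moreover have "u + b - real (Suc n) * pi / 2 = (u - real n * pi / 2) + b - pi / 2"
      "u - b - real (Suc n) * pi / 2 = (u - real n * pi / 2) - b - pi / 2"
      by (simp_all add: algebra_simps add_divide_distrib)
    ultimately show ?thesis by (simp only:)
  qed
  have "2 ^ card (insert a A) * (\<Prod>i\<in>insert a A. sin (r i)) =
      2 * sin (r a) * (2 ^ card A * (\<Prod>i\<in>A. sin (r i)))"
    using insert.hyps by simp
  also have "\<dots> = (\<Sum>I\<in>Pow A. (- 1) ^ card (A - I) *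
      (2 * sin (r a) * cos (signed_sum r A I - real (card A) * pi / 2)))"
    unfolding insert.IH sum_distrib_left by (intro sum.cong) simp_all
  also have "\<dots> = (\<Sum>I\<in>Pow (insert a A). (- 1) ^ card (insert a A - I) *
      cos (signed_sum r (insert a A) I - real (card (insert a A)) * pi / 2))"
    unfolding sum_Pow_insert [OF insert.hyps] step
    by (intro sum.cong)
       (simp_all add: card_insert_Diff signed_sum_insert insert.hyps right_diff_distrib del: of_nat_Suc)
  finally show ?case .
qed (simp add: signed_sum_def)

section \<open>Finite differences of polynomials\<close>

text \<open>The leading terms cancel. In Horner form, with \<open>a + x q(x)\<close> for the
  polynomial, the difference is \<open>c q(x + c) + x (q(x + c) - q(x))\<close>, which suits
  induction.\<close>

lemma degree_poly_shift_diff: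
  fixes p :: "'a :: comm_ring_1 poly"
  shows "degree (pcompose p [:c, 1:] - p) \<le> degree p - 1"
proof (induction p)
  case (pCons a p)
  have eq: "pcompose (pCons a p) [:c, 1:] - pCons a p
      = smult c (pcompose p [:c, 1:]) + pCons 0 (pcompose p [:c, 1:] - p)"
    by (simp add: pcompose_pCons)
  have 1: "degree (smult c (pcompose p [:c, 1:])) \<le> degree p"
    using degree_pcompose_le [of p "[:c, 1:]"] degree_smult_le [of c "pcompose p [:c, 1:]"] by simp
  have 2: "degree (pCons 0 (pcompose p [:c, 1:] - p)) \<le> degree p"
  \<comment> \<open>With truncated subtraction the induction hypothesis is too weak for constant
    \<open>p\<close>: it would allow degree 1 after \<open>pCons\<close>. There the difference is 0
    outright.\<close>
  proof (cases "degree p = 0")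
    case True
    then obtain b where "p = [:b:]" by (rule degree_eq_zeroE)
    then show ?thesis by simp
  next
    case False
    then show ?thesis using pCons.IH by (auto intro: order_trans [OF degree_pCons_le])
  qed
  show ?case
    unfolding eq using degree_add_le [OF 1 2] by (cases "p = 0") auto
qed simp

text \<open>The disjunction treats the zero polynomial as having degree below 0, so that the
  induction over the index set can end at the empty set.\<close>

lemma degree_poly_central_diff_less:
  fixes p :: "'a :: comm_ring_1 poly"
  assumes "p = 0 \<or> degree p < Suc n"
  shows "pcompose p [:c, 1:] - pcompose p [:- c, 1:] = 0 \<or>
    degree (pcompose p [:c, 1:] - pcompose p [:- c, 1:]) < n"
proof (cases "degree p = 0")
  case True
  then obtain b where "p = [:b:]" by (rule degree_eq_zeroE)
  then show ?thesis by simp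
next
  case False
  have "degree ((pcompose p [:c, 1:] - p) - (pcompose p [:- c, 1:] - p)) \<le> degree p - 1"
    by (intro degree_diff_le degree_poly_shift_diff)
  then show ?thesis using False assms by auto
qed

text \<open>Adding an index \<open>a\<close> replaces \<open>P\<close> by its central difference
  with shift \<open>r a\<close>. Each difference lowers the degree, and \<open>card A\<close> of
  them leave nothing.\<close>

lemma alternating_sum_poly_signed_sum:
  assumes "finite A" "P = 0 \<or> degree P < card A"
  shows "(\<Sum>I\<in>Pow A. (- 1) ^ card (A - I) * poly P (signed_sum r A I)) = 0"
  using assms
proof (induction A arbitrary: P rule: finite_induct)
  case empty
  then show ?case by simp
next
  case (insert a A)
  let ?Q = "pcompose P [:r a, 1:] - pcompose P [:- r a, 1:]"
  have "(\<Sum>I\<in>Pow (insert a A). (- 1) ^ card (insert a A - I) * poly P (signed_sum r (insert a A) I))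
      = (\<Sum>I\<in>Pow A. (- 1) ^ card (A - I) * poly ?Q (signed_sum r A I))"
    unfolding sum_Pow_insert [OF insert.hyps]
    by (intro sum.cong)
       (simp_all add: card_insert_Diff signed_sum_insert insert.hyps poly_pcompose algebra_simps)
  also have "\<dots> = 0"
    by (rule insert.IH, rule degree_poly_central_diff_less) (use insert.prems insert.hyps in auto)
  finally show ?case .
qed

subsection \<open>Evaluation of the volume\<close>

lemma signed_sum_scale: "signed_sum (\<lambda>i. c * r i) A I = c * signed_sum r A I"
  by (simp add: signed_sum_def sum_distrib_left right_diff_distrib)

lemma signed_sum_Compl:
  assumes "I \<subseteq> A"
  shows "signed_sum r A (A - I) = - signed_sum r A I"
  using assms by (simp add: signed_sum_def double_diff)

lemma abs_signed_sum_le: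
  assumes "finite A" "I \<subseteq> A" "\<And>i. i \<in> A \<Longrightarrow> 0 \<le> r i"
  shows "\<bar>signed_sum r A I\<bar> \<le> sum r A"
proof -
  have "sum r A = sum r I + sum r (A - I)"
    using assms by (simp add: sum.subset_diff add.commute)
  moreover have "0 \<le> sum r I" "0 \<le> sum r (A - I)"
    using assms by (auto intro!: sum_nonneg)
  ultimately show ?thesis by (simp add: signed_sum_def abs_le_iff)
qed

text \<open>The common form of the two formulas, before the parity of \<open>N\<close> is used.\<close>

definition signed_volume :: "nat \<Rightarrow> (nat \<Rightarrow> real) \<Rightarrow> real" where
  "signed_volume N r = - (1 / (4 * fact (N - 3))) * (\<Sum>I\<in>Pow {1..N}. (- 1) ^ card ({1..N} - I) *
     (sgn (signed_sum r {1..N} I) * signed_sum r {1..N} I ^ (N - 3)))"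

text \<open>The sines are expanded at each frequency, and the finite sum over \<open>I\<close> is
  then exchanged with the series. The factor is \<open>2 ^ (N - 1) / pi\<close> divided by
  \<open>2 ^ N\<close>.\<close>

lemma volume_S3_eq_fourier_sum:
  assumes N: "N \<ge> 3" and small: "\<And>I. I \<subseteq> {1..N} \<Longrightarrow> \<bar>signed_sum r {1..N} I\<bar> < 2 * pi"
  shows "volume_S3 N r = - (1 / (2 * pi)) * (\<Sum>I\<in>Pow {1..N}.
    (- 1) ^ card ({1..N} - I) * fourier_sum (N - 2) (signed_sum r {1..N} I))"
proof -
  let ?A = "{1..N}"
  let ?S = "\<Sum>I\<in>Pow ?A. (- 1) ^ card (?A - I) * fourier_sum (N - 2) (signed_sum r ?A I)"
  have coeff: "(\<Prod>i\<in>?A. sin (real (Suc k) * r i)) / real (Suc k) ^ (N - 2) =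
      - (1 / 2 ^ N) * (\<Sum>I\<in>Pow ?A. (- 1) ^ card (?A - I) * fourier_term (N - 2) k (signed_sum r ?A I))"
    for k
  proof -
    \<comment> \<open>The phases for \<open>N\<close> and \<open>N - 2\<close> differ by
      \<open>pi\<close>, which is the source of the minus sign.\<close>
    have "real (N - 2) = real N - 2" using N by simp
    then have "u - real N * pi / 2 = (u - real (N - 2) * pi / 2) - pi" for u
      by (simp only:) (simp add: field_simps)
    then have shift: "cos (u - real N * pi / 2) = - cos (u - real (N - 2) * pi / 2)" for u
      by (simp only: cos_minus_pi)
    have "2 ^ N * (\<Prod>i\<in>?A. sin (real (Suc k) * r i)) =
        - (\<Sum>I\<in>Pow ?A. (- 1) ^ card (?A - I)
            * cos (real (Suc k) * signed_sum r ?A I - real (N - 2) * pi / 2))"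
      using prod_sin_eq_sum_cos [of ?A "\<lambda>i. real (Suc k) * r i"]
      by (simp add: signed_sum_scale shift sum_negf del: of_nat_Suc of_nat_diff)
    then have "(\<Prod>i\<in>?A. sin (real (Suc k) * r i)) =
        - (1 / 2 ^ N) * (\<Sum>I\<in>Pow ?A. (- 1) ^ card (?A - I)
            * cos (real (Suc k) * signed_sum r ?A I - real (N - 2) * pi / 2))"
      by (simp add: field_simps del: of_nat_Suc)
    moreover have "(\<Sum>I\<in>Pow ?A. (- 1) ^ card (?A - I) * fourier_term (N - 2) k (signed_sum r ?A I)) =
        (\<Sum>I\<in>Pow ?A. (- 1) ^ card (?A - I)
          * cos (real (Suc k) * signed_sum r ?A I - real (N - 2) * pi / 2)) / real (Suc k) ^ (N - 2)"
      by (simp add: fourier_term_def sum_divide_distrib del: of_nat_Suc)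
    ultimately show ?thesis
      by (simp only: times_divide_eq_right)
  qed
  have "(\<lambda>k. \<Sum>I\<in>Pow ?A. (- 1) ^ card (?A - I) * fourier_term (N - 2) k (signed_sum r ?A I)) sums ?S"
    unfolding fourier_sum_def
    by (intro sums_sum sums_mult summable_sums summable_fourier_term) (use N small in auto)
  then have "(\<lambda>k. (\<Prod>i\<in>?A. sin (real (Suc k) * r i)) / real (Suc k) ^ (N - 2)) sums
      (- (1 / 2 ^ N) * ?S)"
    unfolding coeff by (rule sums_mult)
  moreover have "(2::real) ^ N = 2 * 2 ^ (N - 1)"
    using N by (simp flip: power_Suc)
  ultimately show ?thesis
    unfolding volume_S3_def by (simp add: sums_iff)
qed

text \<open>The polynomial part has degree at most \<open>N - 2\<close>, less than the number of
  indices, so its alternating sum vanishes. In the rest, \<open>pi / 2\<close> times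
  \<open>1 / (2 * pi)\<close> leaves 1/4.\<close>

lemma volume_S3_eq_signed_volume:
  assumes N: "N \<ge> 3" and small: "\<And>I. I \<subseteq> {1..N} \<Longrightarrow> \<bar>signed_sum r {1..N} I\<bar> < 2 * pi"
  shows "volume_S3 N r = signed_volume N r"
proof -
  let ?A = "{1..N}"
  let ?s = "signed_sum r ?A"
  have Suc: "N - 2 = Suc (N - 3)" using N by simp
  obtain P where P: "degree P \<le> N - 2" "\<And>x. \<bar>x\<bar> < 2 * pi \<Longrightarrow>
      fourier_sum (N - 2) x = poly P x + pi / 2 * (sgn x * x ^ (N - 3) / fact (N - 3))"
    using fourier_sum_eq_poly [of "N - 3"] unfolding Suc by blast
  have "(\<Sum>I\<in>Pow ?A. (- 1) ^ card (?A - I) * fourier_sum (N - 2) (?s I)) =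
      (\<Sum>I\<in>Pow ?A. (- 1) ^ card (?A - I) * poly P (?s I)) + (\<Sum>I\<in>Pow ?A.
        pi / 2 / fact (N - 3) * ((- 1) ^ card (?A - I) * (sgn (?s I) * ?s I ^ (N - 3))))"
    unfolding sum.distrib [symmetric]
  proof (intro sum.cong refl)
    fix I assume "I \<in> Pow ?A"
    then have "\<bar>?s I\<bar> < 2 * pi" by (intro small) simp
    from P(2) [OF this]
    show "(- 1) ^ card (?A - I) * fourier_sum (N - 2) (?s I) =
        (- 1) ^ card (?A - I) * poly P (?s I) +
        pi / 2 / fact (N - 3) * ((- 1) ^ card (?A - I) * (sgn (?s I) * ?s I ^ (N - 3)))"
      by (simp only:) (simp add: algebra_simps)
  qed
  also have "(\<Sum>I\<in>Pow ?A. (- 1) ^ card (?A - I) * poly P (?s I)) = 0"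
    by (rule alternating_sum_poly_signed_sum) (use P(1) N in auto)
  finally have "(\<Sum>I\<in>Pow ?A. (- 1) ^ card (?A - I) * fourier_sum (N - 2) (?s I)) =
      pi / 2 / fact (N - 3)
        * (\<Sum>I\<in>Pow ?A. (- 1) ^ card (?A - I) * (sgn (?s I) * ?s I ^ (N - 3)))"
    by (simp add: sum_distrib_left)
  moreover have "volume_S3 N r = - (1 / (2 * pi)) *
      (\<Sum>I\<in>Pow ?A. (- 1) ^ card (?A - I) * fourier_sum (N - 2) (?s I))"
    by (rule volume_S3_eq_fourier_sum [OF N small])
  ultimately show ?thesis
    by (simp add: signed_volume_def)
qed

section \<open>Existence and uniqueness of the Euclidean volume\<close>

lemma is_volume_E3_signed_volume:
  assumes N: "N \<ge> 3"
  shows "is_volume_E3 N (signed_volume N)"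
  unfolding is_volume_E3_def
\<comment> \<open>Side-lengths below \<open>2 * pi / N\<close> have total below
  \<open>2 * pi\<close>, which bounds every signed sum.\<close>
proof (intro conjI allI impI exI [of _ "2 * pi / real N"])
  fix r :: "nat \<Rightarrow> real" and c :: real
  assume "0 < c"
  then show "signed_volume N (\<lambda>i. c * r i) = c ^ (N - 3) * signed_volume N r"
    by (simp add: signed_volume_def signed_sum_scale sgn_mult power_mult_distrib
        sum_distrib_left mult.left_commute)
next
  show "0 < 2 * pi / real N" using N by simp
  fix r :: "nat \<Rightarrow> real"
  assume r: "side_lengths N r" "\<forall>i\<in>{1..N}. r i < 2 * pi / real N"
  have "sum r {1..N} < (\<Sum>i\<in>{1..N}. 2 * pi / real N)"
    using r(2) N by (intro sum_strict_mono) auto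
  also have "\<dots> = 2 * pi" using N by simp
  finally have "sum r {1..N} < 2 * pi" .
  moreover have "\<bar>signed_sum r {1..N} I\<bar> \<le> sum r {1..N}" if "I \<subseteq> {1..N}" for I
    using that r(1) by (intro abs_signed_sum_le) (auto simp: side_lengths_def less_imp_le)
  ultimately show "signed_volume N r = volume_S3 N r"
    by (intro volume_S3_eq_signed_volume [OF N, symmetric]) (meson le_less_trans)
qed

text \<open>Scale \<open>r\<close> down until both functions equal the spherical volume, then cancel
  the power of the scaling factor by homogeneity.\<close>

lemma is_volume_E3_unique:
  assumes V: "is_volume_E3 N V" and W: "is_volume_E3 N W" and r: "side_lengths N r"
  shows "V r = W r"
proof -
  obtain d where d: "0 < d"
    "\<And>s. side_lengths N s \<Longrightarrow> \<forall>i\<in>{1..N}. s i < d \<Longrightarrow> V s = volume_S3 N s"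
    using V unfolding is_volume_E3_def by blast
  obtain e where e: "0 < e"
    "\<And>s. side_lengths N s \<Longrightarrow> \<forall>i\<in>{1..N}. s i < e \<Longrightarrow> W s = volume_S3 N s"
    using W unfolding is_volume_E3_def by blast
  have pos: "0 < r i" if "i \<in> {1..N}" for i using that r by (simp add: side_lengths_def)
  \<comment> \<open>The summand 1 makes \<open>m\<close> positive and strictly larger than each
    side, so that scaling by \<open>min d e / m\<close> lands strictly below both
    thresholds.\<close>
  define m where "m = 1 + sum r {1..N}"
  have less_m: "r i < m" if "i \<in> {1..N}" for i
    using member_le_sum [OF that, of r] pos unfolding m_def by (force simp: less_imp_le)
  have m: "0 < m"
    using pos unfolding m_def by (intro add_pos_nonneg sum_nonneg) (auto simp: less_imp_le)
  define c where "c = min d e / m"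
  have c: "0 < c" using d(1) e(1) m by (simp add: c_def)
  have "c * r i < min d e" if "i \<in> {1..N}" for i
    using mult_strict_left_mono [OF less_m [OF that] c] m by (simp add: c_def)
  moreover have "side_lengths N (\<lambda>i. c * r i)"
    using pos c by (simp add: side_lengths_def)
  ultimately have "V (\<lambda>i. c * r i) = W (\<lambda>i. c * r i)"
    using d(2) e(2) by simp
  then have "c ^ (N - 3) * V r = c ^ (N - 3) * W r"
    using V W r c unfolding is_volume_E3_def by metis
  then show ?thesis using c by simp
qed

lemma volume_E3_eq_signed_volume:
  assumes "N \<ge> 3" "side_lengths N r"
  shows "volume_E3 N r = signed_volume N r"
  unfolding volume_E3_def
  using is_volume_E3_signed_volume [OF assms(1)] is_volume_E3_unique [OF _ _ assms(2)]
  by (intro the_equality) blast+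

section \<open>Specialization to even and odd numbers of sides\<close>

lemma even_card_Diff:
  assumes "finite A" "I \<subseteq> A"
  shows "even (card (A - I)) \<longleftrightarrow> (even (card A) \<longleftrightarrow> even (card I))"
proof -
  have "card A = card (A - I) + card I"
    using assms by (simp add: card_Diff_subset finite_subset card_mono)
  then show ?thesis by auto
qed

text \<open>The exponent is odd, so the sign turns the power into one of the absolute value; as the
  number of indices is even, \<open>I\<close> and its complement have the same parity.\<close>

lemma signed_volume_even:
  assumes "n \<ge> 2"
  shows "signed_volume (2 * n) r = - (1 / (4 * fact (2 * n - 3))) *
    (\<Sum>I\<in>Pow {1..2 * n}. (- 1) ^ card I * \<bar>signed_sum r {1..2 * n} I\<bar> ^ (2 * n - 3))"
proof -
  have odd: "2 * n - 3 = Suc (2 * (n - 2))" using assms by simp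
  have "sgn x * x ^ (2 * n - 3) = \<bar>x\<bar> ^ (2 * n - 3)" for x :: real
  proof -
    have "sgn x * x ^ (2 * n - 3) = (sgn x * x) * \<bar>x\<bar> ^ (2 * (n - 2))"
      unfolding odd by (simp add: power_even_abs)
    also have "sgn x * x = \<bar>x\<bar>" by (simp add: abs_sgn mult.commute)
    finally show ?thesis unfolding odd by simp
  qed
  moreover have "(- 1 :: real) ^ card ({1..2 * n} - I) = (- 1) ^ card I" if "I \<subseteq> {1..2 * n}" for I
  proof -
    have "even (card I) = even (card ({1..2 * n} - I))"
      using even_card_Diff [OF _ that] by simp
    then show ?thesis by (simp add: minus_one_power_iff)
  qed
  ultimately show ?thesis
    unfolding signed_volume_def by simp
qed

text \<open>Complementation exchanges odd and even subsets and negates both the signed sum and the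
  alternating sign. The even subsets thus contribute as much as the odd ones, and 1/4 becomes
  1/2.\<close>

lemma signed_volume_odd:
  assumes "n \<ge> 1"
  shows "signed_volume (2 * n + 1) r = - (1 / (2 * fact (2 * n - 2))) *
    (\<Sum>I | I \<subseteq> {1..2 * n + 1} \<and> odd (card I).
      sgn (signed_sum r {1..2 * n + 1} I) * signed_sum r {1..2 * n + 1} I ^ (2 * n - 2))"
proof -
  define A where "A = {1..2 * n + 1}"
  have A: "finite A" "card A = 2 * n + 1" by (simp_all add: A_def)
  define g where "g = (\<lambda>I. sgn (signed_sum r A I) * signed_sum r A I ^ (2 * n - 2))"
  let ?odd = "{I. I \<subseteq> A \<and> odd (card I)}" and ?even = "{I. I \<subseteq> A \<and> even (card I)}"
  have parity: "even (card (A - I)) = odd (card I)" if "I \<subseteq> A" for I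
    using even_card_Diff [OF A(1) that] A(2) by simp
  have even: "even (2 * n - 2)" by simp
  \<comment> \<open>The power is even, so only \<open>sgn\<close> changes sign. For
    \<open>n = 1\<close> the power is constantly 1 and \<open>g\<close> is the sign alone.\<close>
  have g_Compl: "g (A - I) = - g I" if "I \<subseteq> A" for I
    unfolding g_def signed_sum_Compl [OF that] by (simp add: sgn_minus power_minus_even [OF even])
  have "(\<Sum>I\<in>Pow A. (- 1) ^ card (A - I) * g I) =
      (\<Sum>I\<in>?odd. (- 1) ^ card (A - I) * g I) + (\<Sum>I\<in>?even. (- 1) ^ card (A - I) * g I)"
    by (subst sum.union_disjoint [symmetric]) (auto simp: A(1) intro!: sum.cong)
  also have "(\<Sum>I\<in>?odd. (- 1) ^ card (A - I) * g I) = sum g ?odd"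
    by (intro sum.cong) (auto simp: parity)
  also have "(\<Sum>I\<in>?even. (- 1) ^ card (A - I) * g I) = sum g ?odd"
    by (rule sum.reindex_bij_witness [where i = "\<lambda>I. A - I" and j = "\<lambda>I. A - I"])
       (auto simp: parity g_Compl double_diff)
  finally show ?thesis
    unfolding signed_volume_def g_def A_def [symmetric] by (simp add: field_simps)
qed

theorem proposition3p1:
  "(\<forall>(n::nat) (r::nat \<Rightarrow> real). n \<ge> 2 \<longrightarrow> side_lengths (2 * n) r \<longrightarrow>
      volume_E3 (2 * n) r =
        - (1 / (4 * fact (2 * n - 3))) *
          (\<Sum>I\<in>Pow {1..2 * n}. (- 1) ^ card I *
             \<bar>(\<Sum>i\<in>I. r i) - (\<Sum>i\<in>{1..2 * n} - I. r i)\<bar> ^ (2 * n - 3))) \<and>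
   (\<forall>(n::nat) (r::nat \<Rightarrow> real). n \<ge> 1 \<longrightarrow> side_lengths (2 * n + 1) r \<longrightarrow>
      volume_E3 (2 * n + 1) r =
        - (1 / (2 * fact (2 * n - 2))) *
          (\<Sum>I | I \<subseteq> {1..2 * n + 1} \<and> odd (card I).
             sgn ((\<Sum>i\<in>I. r i) - (\<Sum>i\<in>{1..2 * n + 1} - I. r i)) *
             ((\<Sum>i\<in>I. r i) - (\<Sum>i\<in>{1..2 * n + 1} - I. r i)) ^ (2 * n - 2)))"
proof (intro conjI allI impI)
  fix n :: nat and r :: "nat \<Rightarrow> real"
  assume n: "n \<ge> 2" and r: "side_lengths (2 * n) r"
  have "3 \<le> 2 * n" using n by simp
  from volume_E3_eq_signed_volume [OF this r] signed_volume_even [OF n, of r]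
  show "volume_E3 (2 * n) r = - (1 / (4 * fact (2 * n - 3))) *
      (\<Sum>I\<in>Pow {1..2 * n}. (- 1) ^ card I *
        \<bar>(\<Sum>i\<in>I. r i) - (\<Sum>i\<in>{1..2 * n} - I. r i)\<bar> ^ (2 * n - 3))"
    unfolding signed_sum_def by (rule trans)
next
  fix n :: nat and r :: "nat \<Rightarrow> real"
  assume n: "n \<ge> 1" and r: "side_lengths (2 * n + 1) r"
  have "3 \<le> 2 * n + 1" using n by simp
  from volume_E3_eq_signed_volume [OF this r] signed_volume_odd [OF n, of r]
  show "volume_E3 (2 * n + 1) r = - (1 / (2 * fact (2 * n - 2))) *
      (\<Sum>I | I \<subseteq> {1..2 * n + 1} \<and> odd (card I).
        sgn ((\<Sum>i\<in>I. r i) - (\<Sum>i\<in>{1..2 * n + 1} - I. r i)) *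
        ((\<Sum>i\<in>I. r i) - (\<Sum>i\<in>{1..2 * n + 1} - I. r i)) ^ (2 * n - 2))"
    unfolding signed_sum_def by (rule trans)
qed

end
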